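(* Let $W$ be an irreducible finite complex reflection group with reflection representation $V\cong\mathbb{C}^N$ and reflection arrangement $\mathcal{A}$, and let $m\colon\mathcal{A}\to\mathbb{N}$ be a $W$-invariant multiplicity function. Then there is an isomorphism of $(SV^* )^W$-modules $$\Theta\colon \mathrm{Hom}_W(V^*,Q_m)\xrightarrow{\ \sim\ } D_m^W,\qquad \Theta(\varphi)=\sum_{i=1}^N\varphi(x_i)\,\partial_i ,$$ and its inverse is given by $\Theta^{-1}\big(\sum_{i=1}^N f_i\partial_i\big)(x_k)=f_k$ for $1\le k\le N$.
   Context: $\mathbb{N}=\{0,1,2,\dots\}$. $W$ is an irreducible finite complex reflection group, $V\cong\mathbb{C}^N$ its reflection representation, $e_1,\dots,e_N$ a basis of $V$, $x_1,\dots,x_N\in V^*$ the dual basis, $SV^*=\mathbb{C}[x_1,\dots,x_N]$, on which $W$ acts by $(wf)(x)=f(w^{-1}x)$. $\mathcal{A}$ is the set of reflection hyperplanes; for $H\in\mathcal{A}$, $\alpha_H\in V^*$ satisfies $H=\ker\alpha_H$, $W_H$ is the (cyclic) pointwise stabiliser of $H$ in $W$ and $n_H=|W_H|$. A $W$-invariant function $m\colon\mathcal{A}\to\mathbb{N}$ is fixed, $m_H=m(H)$. Quasi-invariants: put $e_{H,i}=\sum_{w\in W_H}(\det w)^i w\in\mathbb{C}W_H$ for $1\le i\le n_H-1$, where $\det w$ is the determinant of $w$ on $V$. $Q_m$ is the set of $p\in SV^*$ such that $e_{H,i}(p)$ is divisible by $\alpha_H^{m_Hn_H}$ for all $H\in\mathcal{A}$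 and $1\le i\le n_H-1$. It is a $W$-submodule and an $(SV^* )^W$-submodule of $SV^*$. Logarithmic vector fields: $\mathrm{Der}$ is the $SV^*$-module of $\mathbb{C}$-linear derivations $L=\sum_i f_i\partial_i$ ($f_i\in SV^*$, $\partial_i=\partial_{x_i}$) of $SV^*$, with $W$-action $(wL)(\varphi)=w(L(w^{-1}\varphi))$. $D_m=\{L\in\mathrm{Der}\colon L(\alpha_H)\in\alpha_H^{m_Hn_H+1}SV^*\ \text{for all }H\in\mathcal{A}\}$, and $D_m^W$ is the space of $W$-invariant elements of $D_m$, an $(SV^* )^W$-module. *)

theory Defs
  imports
    "HOL-Analysis.Analysis"
    "HOL-Library.Poly_Mapping"
    "HOL-Library.FuncSet"
    "HOL-Algebra.Generated_Groups"
    "HOL-Algebra.Module"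
begin

section \<open>The polynomial ring \<open>SV\<^sup>*\<close>\<close>

text \<open>
  The basis of \<open>V\<close> is used to identify \<open>V\<close> with \<^typ>\<open>complex ^ 'n\<close> and \<open>GL(V)\<close> with the
  invertible matrices.  The symmetric algebra \<open>SV\<^sup>*\<close> is the polynomial ring in the coordinates,
  i.e. the monoid algebra of the exponent vectors \<open>'n \<Rightarrow>\<^sub>0 nat\<close>; \<open>V\<^sup>*\<close> is its subspace of
  homogeneous linear polynomials.
\<close>

type_synonym 'n cpoly = "('n \<Rightarrow>\<^sub>0 nat) \<Rightarrow>\<^sub>0 complex"

definition Const :: "complex \<Rightarrow> 'n cpoly" where
  "Const c = Poly_Mapping.single 0 c"

definition Var :: "'n \<Rightarrow> 'n cpoly" where
  "Var i = Poly_Mapping.single (Poly_Mapping.single i 1) 1"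

definition Vdual :: "('n::finite) cpoly set" where
  "Vdual = range (\<lambda>c. \<Sum>i\<in>UNIV. Const (c i) * Var i)"

text \<open>
  The value of \<open>p\<close> at the point with coordinates \<open>g i\<close>, the coefficients being mapped
  along \<open>h\<close>.
\<close>

definition aeval :: "(complex \<Rightarrow> 'b) \<Rightarrow> ('n \<Rightarrow> 'b) \<Rightarrow> ('n::finite) cpoly \<Rightarrow> 'b::comm_ring_1" where
  "aeval h g p = (\<Sum>k\<in>Poly_Mapping.keys p.
     h (Poly_Mapping.lookup p k) * (\<Prod>i\<in>UNIV. g i ^ Poly_Mapping.lookup k i))"

definition eval :: "('n::finite) cpoly \<Rightarrow> complex ^ 'n \<Rightarrow> complex" where
  "eval p v = aeval (\<lambda>c. c) (\<lambda>i. v $ i) p"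

text \<open>
  The action \<open>(w f)(x) = f (w\<inverse> x)\<close>, as the substitution of the coordinates of \<open>w\<inverse> x\<close> for
  the variables; see \<open>eval_act\<close> below.
\<close>

definition act :: "complex ^ 'n ^ 'n \<Rightarrow> ('n::finite) cpoly \<Rightarrow> 'n cpoly" where
  "act w = aeval Const (\<lambda>i. \<Sum>j\<in>UNIV. Const (matrix_inv w $ i $ j) * Var j)"

text \<open>
  The formal partial derivative.  Subtraction of exponents is truncated, but where it is
  the coefficient vanishes.
\<close>

definition pdiff :: "'n \<Rightarrow> 'n cpoly \<Rightarrow> 'n cpoly" where
  "pdiff i p = (\<Sum>k\<in>Poly_Mapping.keys p.
     Poly_Mapping.single (k - Poly_Mapping.single i 1)
       (of_nat (Poly_Mapping.lookup k i) * Poly_Mapping.lookup p k))"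


section \<open>Reflection groups\<close>

definition GL :: "(complex ^ 'n ^ 'n) monoid" where
  "GL = \<lparr>carrier = {A. invertible A}, mult = (**), one = mat 1\<rparr>"

definition fixspace :: "complex ^ 'n ^ 'n \<Rightarrow> (complex ^ 'n) set" where
  "fixspace s = {v. s *v v = v}"

text \<open>
  A reflection fixes a hyperplane pointwise and is not the identity.  Finite order is not
  required here, since it is automatic in a finite group.
\<close>

definition is_reflection :: "complex ^ 'n ^ 'n \<Rightarrow> bool" where
  "is_reflection s \<longleftrightarrow> invertible s \<and> vec.dim (fixspace s) + 1 = CARD('n)"

definition reflections :: "(complex ^ 'n ^ 'n) set \<Rightarrow> (complex ^ 'n ^ 'n) set" where
  "reflections W = {s \<in> W. is_reflection s}"

definition finite_reflection_group :: "(complex ^ 'n ^ 'n) set \<Rightarrow> bool" where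
  "finite_reflection_group W \<longleftrightarrow>
     finite W \<and> subgroup W GL \<and> generate GL (reflections W) = W"

definition irreducible_on_V :: "(complex ^ 'n ^ 'n) set \<Rightarrow> bool" where
  "irreducible_on_V W \<longleftrightarrow>
     (\<forall>U. vec.subspace U \<and> (\<forall>w\<in>W. \<forall>u\<in>U. w *v u \<in> U) \<longrightarrow> U = {0} \<or> U = UNIV)"

definition arrangement :: "(complex ^ 'n ^ 'n) set \<Rightarrow> (complex ^ 'n) set set" where
  "arrangement W = fixspace ` reflections W"

definition stab :: "(complex ^ 'n ^ 'n) set \<Rightarrow> (complex ^ 'n) set \<Rightarrow> (complex ^ 'n ^ 'n) set" where
  "stab W H = {w \<in> W. \<forall>v\<in>H. w *v v = v}"

definition invariant_mult :: "(complex ^ 'n ^ 'n) set \<Rightarrow> ((complex ^ 'n) set \<Rightarrow> nat) \<Rightarrow> bool" where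
  "invariant_mult W m \<longleftrightarrow> (\<forall>w\<in>W. \<forall>H\<in>arrangement W. m ((*v) w ` H) = m H)"

definition defining_forms ::
    "(complex ^ 'n ^ 'n) set \<Rightarrow> ((complex ^ 'n) set \<Rightarrow> ('n::finite) cpoly) \<Rightarrow> bool" where
  "defining_forms W \<alpha> \<longleftrightarrow>
     (\<forall>H\<in>arrangement W. \<alpha> H \<in> Vdual \<and> H = {v. eval (\<alpha> H) v = 0})"


section \<open>Quasi-invariants and logarithmic vector fields\<close>

definition e_op ::
    "(complex ^ 'n ^ 'n) set \<Rightarrow> (complex ^ 'n) set \<Rightarrow> nat \<Rightarrow> ('n::finite) cpoly \<Rightarrow> 'n cpoly" where
  "e_op W H i p = (\<Sum>w\<in>stab W H. Const (det w ^ i) * act w p)"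

definition quasi_invariants ::
    "(complex ^ 'n ^ 'n) set \<Rightarrow> ((complex ^ 'n) set \<Rightarrow> ('n::finite) cpoly)
      \<Rightarrow> ((complex ^ 'n) set \<Rightarrow> nat) \<Rightarrow> 'n cpoly set" where
  "quasi_invariants W \<alpha> m =
     {p. \<forall>H\<in>arrangement W. \<forall>i\<in>{1..card (stab W H) - 1}.
           \<alpha> H ^ (m H * card (stab W H)) dvd e_op W H i p}"

definition Der :: "('n cpoly \<Rightarrow> 'n cpoly) set" where
  "Der = {L. (\<forall>p q. L (p + q) = L p + L q) \<and> (\<forall>c p. L (Const c * p) = Const c * L p)
           \<and> (\<forall>p q. L (p * q) = L p * q + p * L q)}"

definition log_fields ::
    "(complex ^ 'n ^ 'n) set \<Rightarrow> ((complex ^ 'n) set \<Rightarrow> ('n::finite) cpoly)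
      \<Rightarrow> ((complex ^ 'n) set \<Rightarrow> nat) \<Rightarrow> ('n cpoly \<Rightarrow> 'n cpoly) set" where
  "log_fields W \<alpha> m =
     {L \<in> Der. \<forall>H\<in>arrangement W. \<alpha> H ^ (m H * card (stab W H) + 1) dvd L (\<alpha> H)}"

definition act_der ::
    "complex ^ 'n ^ 'n \<Rightarrow> ('n cpoly \<Rightarrow> 'n cpoly) \<Rightarrow> (('n::finite) cpoly \<Rightarrow> 'n cpoly)" where
  "act_der w L = (\<lambda>p. act w (L (act (matrix_inv w) p)))"

definition vector_field :: "('n \<Rightarrow> 'n cpoly) \<Rightarrow> (('n::finite) cpoly \<Rightarrow> 'n cpoly)" where
  "vector_field f = (\<lambda>p. \<Sum>i\<in>UNIV. f i * pdiff i p)"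


section \<open>The modules over the ring of invariants\<close>

definition invariant_ring :: "(complex ^ 'n ^ 'n) set \<Rightarrow> ('n::finite) cpoly ring" where
  "invariant_ring W =
     \<lparr>carrier = {p. \<forall>w\<in>W. act w p = p}, mult = (*), one = 1, zero = 0, add = (+)\<rparr>"

text \<open>
  A map on \<open>V\<^sup>*\<close> is represented by a function that is \<^const>\<open>undefined\<close> outside
  \<^const>\<open>Vdual\<close>, so that equality in \<open>Hom\<^sub>W(V\<^sup>*, Q)\<close> is equality on \<open>V\<^sup>*\<close>.
\<close>

definition equivariant_maps ::
    "(complex ^ 'n ^ 'n) set \<Rightarrow> ('n::finite) cpoly set \<Rightarrow> ('n cpoly \<Rightarrow> 'n cpoly) set" where
  "equivariant_maps W Q =
     {\<phi> \<in> Vdual \<rightarrow>\<^sub>E Q.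
        (\<forall>a\<in>Vdual. \<forall>b\<in>Vdual. \<phi> (a + b) = \<phi> a + \<phi> b) \<and>
        (\<forall>c. \<forall>a\<in>Vdual. \<phi> (Const c * a) = Const c * \<phi> a) \<and>
        (\<forall>w\<in>W. \<forall>a\<in>Vdual. \<phi> (act w a) = act w (\<phi> a))}"

text \<open>
  The record type of modules extends that of rings; its multiplicative fields play no role
  for modules and are left unspecified.
\<close>

definition Hom_module ::
    "(complex ^ 'n ^ 'n) set \<Rightarrow> ('n::finite) cpoly set
      \<Rightarrow> ('n cpoly, 'n cpoly \<Rightarrow> 'n cpoly) module" where
  "Hom_module W Q =
     \<lparr>carrier = equivariant_maps W Q, mult = undefined, one = undefined,
      zero = (\<lambda>a\<in>Vdual. 0), add = (\<lambda>\<phi> \<psi>. \<lambda>a\<in>Vdual. \<phi> a + \<psi> a),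
      smult = (\<lambda>p \<phi>. \<lambda>a\<in>Vdual. p * \<phi> a)\<rparr>"

definition invariant_fields_module ::
    "(complex ^ 'n ^ 'n) set \<Rightarrow> ('n cpoly \<Rightarrow> 'n cpoly) set
      \<Rightarrow> (('n::finite) cpoly, 'n cpoly \<Rightarrow> 'n cpoly) module" where
  "invariant_fields_module W D =
     \<lparr>carrier = {L \<in> D. \<forall>w\<in>W. act_der w L = L}, mult = undefined, one = undefined,
      zero = (\<lambda>q. 0), add = (\<lambda>L M q. L q + M q),
      smult = (\<lambda>p L q. p * L q)\<rparr>"

definition module_iso ::
    "('r, 'c) ring_scheme \<Rightarrow> ('r, 'a, 'd) module_scheme \<Rightarrow> ('r, 'b, 'e) module_scheme
      \<Rightarrow> ('a \<Rightarrow> 'b) set" where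
  "module_iso R M N =
     {f. bij_betw f (carrier M) (carrier N) \<and>
         (\<forall>x\<in>carrier M. \<forall>y\<in>carrier M. f (x \<oplus>\<^bsub>M\<^esub> y) = f x \<oplus>\<^bsub>N\<^esub> f y) \<and>
         (\<forall>r\<in>carrier R. \<forall>x\<in>carrier M. f (r \<odot>\<^bsub>M\<^esub> x) = r \<odot>\<^bsub>N\<^esub> f x)}"

definition Theta :: "('n cpoly \<Rightarrow> 'n cpoly) \<Rightarrow> (('n::finite) cpoly \<Rightarrow> 'n cpoly)" where
  "Theta \<phi> = vector_field (\<lambda>i. \<phi> (Var i))"


section \<open>Consistency of the action with evaluation\<close>

lemma aeval_superset:
  assumes "finite A" "Poly_Mapping.keys p \<subseteq> A" "h 0 = 0"
  shows "aeval h g p =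
    (\<Sum>k\<in>A. h (Poly_Mapping.lookup p k) * (\<Prod>i\<in>UNIV. g i ^ Poly_Mapping.lookup k i))"
  unfolding aeval_def using assms
  by (intro sum.mono_neutral_left) (auto simp: in_keys_iff)

lemma aeval_hom:
  fixes F :: "'b::comm_ring_1 \<Rightarrow> 'c::comm_ring_1"
  assumes "\<And>x y. F (x + y) = F x + F y" "\<And>x y. F (x * y) = F x * F y" "F 1 = 1" "F 0 = 0"
  shows "F (aeval h g p) = aeval (\<lambda>c. F (h c)) (\<lambda>i. F (g i)) p"
proof -
  have s: "F (sum f A) = (\<Sum>a\<in>A. F (f a))" for f :: "'d \<Rightarrow> 'b" and A
    by (induction A rule: infinite_finite_induct) (use assms in auto)
  have pr: "F (prod f A) = (\<Prod>a\<in>A. F (f a))" for f :: "'d \<Rightarrow> 'b" and A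
    by (induction A rule: infinite_finite_induct) (use assms in auto)
  have pw: "F (x ^ n) = F x ^ n" for x n
    by (induction n) (use assms in auto)
  show ?thesis
    by (simp add: aeval_def s pr pw assms(2))
qed

lemma eval_add: "eval (p + q) v = eval p v + eval q v"
proof -
  let ?A = "Poly_Mapping.keys p \<union> Poly_Mapping.keys q"
  have "Poly_Mapping.keys (p + q) \<subseteq> ?A" by (rule Poly_Mapping.keys_add)
  then show ?thesis
    unfolding eval_def
    by (subst (1 2 3) aeval_superset[where A = ?A])
       (auto simp: lookup_add algebra_simps sum.distrib)
qed

lemma eval_0: "eval 0 v = 0"
  by (simp add: eval_def aeval_def)

lemma eval_single:
  "eval (Poly_Mapping.single k c) v = c * (\<Prod>i\<in>UNIV. v $ i ^ Poly_Mapping.lookup k i)"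
  by (simp add: eval_def aeval_def)

lemma eval_sum: "eval (sum f A) v = (\<Sum>a\<in>A. eval (f a) v)"
  by (induction A rule: infinite_finite_induct) (auto simp: eval_0 eval_add)

lemma cpoly_expand:
  "p = (\<Sum>k\<in>Poly_Mapping.keys p. Poly_Mapping.single k (Poly_Mapping.lookup p k))"
  by (rule poly_mapping_eqI)
     (auto simp: lookup_sum lookup_single when_def in_keys_iff sum.delta)

lemma eval_mult: "eval (p * q) v = eval p v * eval q v"
proof -
  have "eval (p * q) v =
    eval ((\<Sum>k\<in>Poly_Mapping.keys p. Poly_Mapping.single k (Poly_Mapping.lookup p k)) *
      (\<Sum>l\<in>Poly_Mapping.keys q. Poly_Mapping.single l (Poly_Mapping.lookup q l))) v"
    using cpoly_expand[of p] cpoly_expand[of q] by simp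
  also have "\<dots> = (\<Sum>k\<in>Poly_Mapping.keys p. \<Sum>l\<in>Poly_Mapping.keys q.
      eval (Poly_Mapping.single k (Poly_Mapping.lookup p k)) v *
      eval (Poly_Mapping.single l (Poly_Mapping.lookup q l)) v)"
    by (simp add: sum_product eval_sum mult_single eval_single lookup_add power_add
        prod.distrib algebra_simps)
  also have "\<dots> = eval p v * eval q v"
    unfolding sum_product[symmetric] eval_sum[symmetric] cpoly_expand[symmetric] ..
  finally show ?thesis .
qed

lemma eval_Const: "eval (Const c) v = c"
  by (simp add: Const_def eval_single)

lemma eval_Var: "eval (Var j) v = v $ j"
proof -
  have "(\<Prod>i\<in>UNIV. v $ i ^ Poly_Mapping.lookup (Poly_Mapping.single j 1) i)
      = (\<Prod>i\<in>UNIV. if i = j then v $ i else 1)"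
    by (intro prod.cong) (auto simp: lookup_single when_def)
  then show ?thesis
    by (simp add: Var_def eval_single)
qed

lemma eval_act: "eval (act w p) v = eval p (matrix_inv w *v v)"
proof -
  have 1: "eval 1 v = 1"
    using eval_Const[of 1 v] by (simp add: Const_def)
  have "eval (act w p) v = aeval (\<lambda>c. eval (Const c) v)
      (\<lambda>i. eval (\<Sum>j\<in>UNIV. Const (matrix_inv w $ i $ j) * Var j) v) p"
    unfolding act_def by (rule aeval_hom) (auto simp: eval_add eval_mult 1 eval_0)
  then show ?thesis
    by (simp add: eval_Const eval_sum eval_mult eval_Var eval_def[of p] matrix_vector_mult_def)
qed

end

theory Submission
  imports Defs "HOL-Computational_Algebra.Polynomial"
begin

text \<open>
  A derivation is determined by its values on \<open>V\<^sup>*\<close>, and it is \<open>W\<close>-invariant iff its restriction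
  \<open>\<phi>\<close> to \<open>V\<^sup>*\<close> is equivariant; the point is that \<open>\<phi>\<close> takes values in \<open>Q\<^sub>m\<close> iff
  \<open>\<alpha>\<^sub>H\<close> to the power \<open>m\<^sub>H n\<^sub>H + 1\<close> divides \<open>\<phi>(\<alpha>\<^sub>H)\<close> for all \<open>H\<close>.  Every \<open>w \<in> W\<^sub>H\<close> acts by
  \<open>w \<alpha>\<^sub>H = (det w)\<^sup>-\<^sup>1 \<alpha>\<^sub>H\<close> and \<open>w b \<in> b + \<complex> \<alpha>\<^sub>H\<close> for \<open>b \<in> V\<^sup>*\<close>, and \<open>det\<close> is faithful on
  \<open>W\<^sub>H\<close>.  As the power sums of \<open>det\<close> over \<open>W\<^sub>H\<close> vanish, \<open>e\<^sub>H\<^sub>,\<^sub>i(\<phi>(b))\<close> is a multiple of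
  \<open>\<phi>(\<alpha>\<^sub>H)\<close>, while \<open>e\<^sub>H\<^sub>,\<^sub>1(\<phi>(\<alpha>\<^sub>H)) = n\<^sub>H \<phi>(\<alpha>\<^sub>H)\<close>.  The additional factor \<open>\<alpha>\<^sub>H\<close> comes
  for free from the semi-invariance of \<open>\<phi>(\<alpha>\<^sub>H)\<close>.

  Polynomial identities are checked pointwise, since a complex polynomial that vanishes
  everywhere is zero.
\<close>

section \<open>Polynomials and derivations\<close>

text \<open>A mixed-radix encoding: if the weight of a new coordinate exceeds every weighted sum
  over the old ones, reduction modulo this weight recovers the old sum, and the remaining difference
  recovers the new coordinate.\<close>

lemma separating_weights:
  fixes K :: "('a \<Rightarrow> nat) set"
  assumes "finite S" "finite K"
  shows "\<exists>u :: 'a \<Rightarrow> nat. \<forall>k\<in>K. \<forall>l\<in>K. (\<Sum>i\<in>S. u i * k i) = (\<Sum>i\<in>S. u i * l i)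
           \<longrightarrow> (\<forall>i\<in>S. k i = l i)"
  using assms(1)
proof (induction S)
  case empty
  then show ?case by simp
next
  case (insert a S)
  then obtain u where u: "\<And>k l. \<lbrakk>k \<in> K; l \<in> K; (\<Sum>i\<in>S. u i * k i) = (\<Sum>i\<in>S. u i * l i)\<rbrakk>
      \<Longrightarrow> \<forall>i\<in>S. k i = l i"
    by metis
  \<comment> \<open>The sum over the finite set \<open>K\<close> bounds each old weighted sum;
    \<open>Suc\<close> makes the bound strict and \<open>M\<close> nonzero, so that \<open>M\<close>
    can be cancelled.\<close>
  define M where "M = Suc (\<Sum>k\<in>K. \<Sum>i\<in>S. u i * k i)"
  have less: "(\<Sum>i\<in>S. u i * k i) < M" if "k \<in> K" for k
    using member_le_sum[OF that, of "\<lambda>k. \<Sum>i\<in>S. u i * k i"] assms(2) by (simp add: M_def)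
  have upd: "(\<Sum>i\<in>insert a S. (u(a := M)) i * k i) = (\<Sum>i\<in>S. u i * k i) + M * k a" for k
  proof -
    have "(\<Sum>i\<in>S. (u(a := M)) i * k i) = (\<Sum>i\<in>S. u i * k i)"
      using insert.hyps by (intro sum.cong) auto
    then show ?thesis
      using insert.hyps by simp
  qed
  show ?case
  proof (intro exI ballI impI)
    fix k l i
    assume kl: "k \<in> K" "l \<in> K" and i: "i \<in> insert a S"
      and "(\<Sum>i\<in>insert a S. (u(a := M)) i * k i) = (\<Sum>i\<in>insert a S. (u(a := M)) i * l i)"
    then have eq: "(\<Sum>i\<in>S. u i * k i) + M * k a = (\<Sum>i\<in>S. u i * l i) + M * l a"
      by (simp only: upd)
    have "(\<Sum>i\<in>S. u i * k i) = (\<Sum>i\<in>S. u i * l i)"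
      using arg_cong[OF eq, of "\<lambda>x. x mod M"] less kl by simp
    moreover from this have "k a = l a"
      using eq by (metis add_left_cancel M_def mult_cancel1 nat.distinct(1))
    ultimately show "k i = l i"
      using u[OF kl] i by auto
  qed
qed

text \<open>
  Substituting \<open>t ^ u\<^sub>i\<close> for the variables, with weights that separate the exponents of \<open>p\<close>,
  reduces the claim to univariate polynomials.
\<close>

lemma eval_eq_0_imp:
  fixes p :: "('n::finite) cpoly"
  assumes "\<And>v. eval p v = 0"
  shows "p = 0"
proof (rule ccontr)
  assume "p \<noteq> 0"
  then obtain k0 where k0: "k0 \<in> Poly_Mapping.keys p"
    by (metis keys_eq_empty ex_in_conv)
  have "\<exists>u. \<forall>k\<in>Poly_Mapping.lookup ` Poly_Mapping.keys p. \<forall>l\<in>Poly_Mapping.lookup ` Poly_Mapping.keys p.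
      (\<Sum>i\<in>UNIV. u i * k i) = (\<Sum>i\<in>UNIV. u i * l i) \<longrightarrow> (\<forall>i\<in>UNIV. k i = l i)"
    by (rule separating_weights) simp_all
  then obtain u :: "'n \<Rightarrow> nat" where
    u: "\<forall>k\<in>Poly_Mapping.lookup ` Poly_Mapping.keys p. \<forall>l\<in>Poly_Mapping.lookup ` Poly_Mapping.keys p.
      (\<Sum>i\<in>UNIV. u i * k i) = (\<Sum>i\<in>UNIV. u i * l i) \<longrightarrow> (\<forall>i\<in>UNIV. k i = l i)"
    by (rule exE)
  define N where "N k = (\<Sum>i\<in>UNIV. u i * Poly_Mapping.lookup k i)" for k :: "'n \<Rightarrow>\<^sub>0 nat"
  define P where "P = (\<Sum>k\<in>Poly_Mapping.keys p. monom (Poly_Mapping.lookup p k) (N k))"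
  have "poly P t = eval p (\<chi> i. t ^ u i)" for t
    by (simp add: P_def N_def poly_sum poly_monom eval_def aeval_def power_mult power_sum)
  then have "P = 0"
    using assms by (intro poly_all_0_iff_0[THEN iffD1]) simp
  have "N k = N k0 \<longleftrightarrow> k = k0" if "k \<in> Poly_Mapping.keys p" for k
    using u[rule_format, OF imageI[OF that] imageI[OF k0]] unfolding N_def
    by (metis UNIV_I poly_mapping_eqI)
  then have "coeff P (N k0) = (\<Sum>k\<in>Poly_Mapping.keys p. if k = k0 then Poly_Mapping.lookup p k else 0)"
    by (auto simp: P_def coeff_sum intro!: sum.cong)
  also have "\<dots> = Poly_Mapping.lookup p k0"
    using k0 by simp
  finally show False
    using \<open>P = 0\<close> k0 by (simp add: in_keys_iff)
qed

lemma eval_1: "eval 1 v = 1"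
  using eval_Const[of 1 v] by (simp add: Const_def)

lemma eval_uminus: "eval (- p) v = - eval p v"
  using eval_add[of p "- p" v] by (simp add: eval_0 add_eq_0_iff)

lemma eval_diff: "eval (p - q) v = eval p v - eval q v"
  using eval_add[of p "- q" v] by (simp add: eval_uminus)

lemma eval_power: "eval (p ^ n) v = eval p v ^ n"
  by (induction n) (auto simp: eval_1 eval_mult)

lemma eval_prod: "eval (prod f A) v = (\<Prod>a\<in>A. eval (f a) v)"
  by (induction A rule: infinite_finite_induct) (auto simp: eval_1 eval_mult)

lemmas eval_simps = eval_0 eval_1 eval_add eval_uminus eval_diff eval_mult eval_sum eval_prod
  eval_power eval_Const eval_Var eval_act

lemma cpoly_eqI:
  assumes "\<And>v. eval p v = eval q v"
  shows "p = q"
  using eval_eq_0_imp[of "p - q"] assms by (simp add: eval_diff)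

lemma Const_0: "Const 0 = 0" and Const_1: "Const 1 = 1"
  by (auto simp: Const_def)

lemma Const_sum: "Const (sum f A) = (\<Sum>a\<in>A. Const (f a) :: ('n::finite) cpoly)"
  by (rule cpoly_eqI) (simp add: eval_simps)

lemma Const_mult: "Const (a * b) = (Const a * Const b :: ('n::finite) cpoly)"
  by (rule cpoly_eqI) (simp add: eval_simps)

text \<open>Constants and variables generate the ring, since a polynomial is the finite sum of its
  monomials.\<close>

lemma cpoly_induct [case_names Const Var add mult]:
  fixes p :: "('n::finite) cpoly"
  assumes C: "\<And>c. P (Const c)" and V: "\<And>i. P (Var i)"
    and A: "\<And>p q. P p \<Longrightarrow> P q \<Longrightarrow> P (p + q)" and M: "\<And>p q. P p \<Longrightarrow> P q \<Longrightarrow> P (p * q)"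
  shows "P p"
proof -
  have pow: "P (q ^ n)" if "P q" for q n
    by (induction n) (use C[of 1] M that in \<open>auto simp: Const_1\<close>)
  have pr: "P (prod f A)" if "\<And>a. P (f a)" for f :: "'n \<Rightarrow> 'n cpoly" and A
    by (induction A rule: infinite_finite_induct) (use C[of 1] M that in \<open>auto simp: Const_1\<close>)
  have su: "P (sum f A)" if "\<And>a. P (f a)" for f :: "('n \<Rightarrow>\<^sub>0 nat) \<Rightarrow> 'n cpoly" and A
    by (induction A rule: infinite_finite_induct) (use C[of 0] A that in \<open>auto simp: Const_0\<close>)
  have "p = (\<Sum>k\<in>Poly_Mapping.keys p. Const (Poly_Mapping.lookup p k) *
      (\<Prod>i\<in>UNIV. Var i ^ Poly_Mapping.lookup k i))"
    by (rule cpoly_eqI) (simp add: eval_simps, simp add: eval_def aeval_def)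
  moreover have "P \<dots>"
    by (intro su M C pr pow V)
  ultimately show ?thesis
    by simp
qed

section \<open>The action of matrices on polynomials\<close>

lemma act_add: "act w (p + q) = act w p + act w q"
  by (rule cpoly_eqI) (simp add: eval_simps)

lemma act_mult: "act w (p * q) = act w p * act w q"
  by (rule cpoly_eqI) (simp add: eval_simps)

lemma act_0: "act w 0 = 0" and act_1: "act w 1 = 1" and act_uminus: "act w (- p) = - act w p"
  and act_Const: "act w (Const c) = Const c"
  by (rule cpoly_eqI, simp add: eval_simps)+

lemmas act_simps = act_add act_mult act_0 act_1 act_uminus act_Const

lemma matrix_inv_mult:
  fixes w :: "complex ^ 'n ^ 'n"
  assumes "invertible w"
  shows "w ** matrix_inv w = mat 1" "matrix_inv w ** w = mat 1"
  using someI_ex[OF assms[unfolded invertible_def]] by (auto simp: matrix_inv_def)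

lemma invertible_matrix_inv:
  fixes w :: "complex ^ 'n ^ 'n"
  shows "invertible w \<Longrightarrow> invertible (matrix_inv w)"
  unfolding invertible_def[of "matrix_inv w"] using matrix_inv_mult by blast

lemma act_inverse:
  assumes "invertible w"
  shows "act (matrix_inv w) (act w p) = p" "act w (act (matrix_inv w) p) = p"
  by (auto intro!: cpoly_eqI simp: eval_act matrix_vector_mul_assoc
      matrix_inv_mult[OF assms] matrix_inv_mult[OF invertible_matrix_inv[OF assms]])

section \<open>Partial derivatives and derivations\<close>

text \<open>Identifies the formal derivative with the analytic one along a coordinate line, so that
  the Leibniz rule for \<open>pdiff\<close> follows from uniqueness of complex derivatives instead
  of a comparison of coefficients.\<close>

lemma deriv_eval_pdiff:
  fixes p :: "('n::finite) cpoly"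
  shows "((\<lambda>x. eval p (\<chi> j. if j = i then x else v $ j)) has_field_derivative eval (pdiff i p) v)
    (at (v $ i))"
proof -
  let ?c = "\<lambda>k. Poly_Mapping.lookup p k" and ?l = "\<lambda>k::'n \<Rightarrow>\<^sub>0 nat. Poly_Mapping.lookup k"
  have 1: "eval p (\<chi> j. if j = i then x else v $ j) =
      (\<Sum>k\<in>Poly_Mapping.keys p. ?c k * (x ^ ?l k i * (\<Prod>j\<in>UNIV - {i}. v $ j ^ ?l k j)))" for x
    unfolding eval_def aeval_def
    by (intro sum.cong refl arg_cong2[where f = "(*)"], subst prod.remove[of UNIV i])
       (auto intro!: prod.cong)
  have 2: "eval (pdiff i p) v =
      (\<Sum>k\<in>Poly_Mapping.keys p. ?c k *
        (of_nat (?l k i) * v $ i ^ (?l k i - 1) * (\<Prod>j\<in>UNIV - {i}. v $ j ^ ?l k j)))"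
    unfolding pdiff_def eval_sum eval_single
  proof (intro sum.cong refl)
    fix k
    have "(\<Prod>j\<in>UNIV. v $ j ^ ?l (k - Poly_Mapping.single i 1) j) =
        v $ i ^ (?l k i - 1) * (\<Prod>j\<in>UNIV - {i}. v $ j ^ ?l k j)"
      by (subst prod.remove[of UNIV i])
         (auto intro!: prod.cong simp: lookup_minus lookup_single when_def)
    then show "of_nat (?l k i) * ?c k * (\<Prod>j\<in>UNIV. v $ j ^ ?l (k - Poly_Mapping.single i 1) j) =
        ?c k * (of_nat (?l k i) * v $ i ^ (?l k i - 1) * (\<Prod>j\<in>UNIV - {i}. v $ j ^ ?l k j))"
      by simp
  qed
  show ?thesis
    unfolding 1 2 by (auto intro!: derivative_eq_intros sum.cong)
qed

lemma eval_pdiff_eqI: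
  assumes "((\<lambda>x. eval p (\<chi> j. if j = i then x else v $ j)) has_field_derivative d) (at (v $ i))"
  shows "eval (pdiff i p) v = d"
  using DERIV_unique[OF deriv_eval_pdiff assms] .

lemma vec_upd_same: "(\<chi> j. if j = i then v $ i else v $ j) = v"
  by (simp add: vec_eq_iff)

lemma pdiff_add:
  fixes p q :: "('n::finite) cpoly"
  shows "pdiff i (p + q) = pdiff i p + pdiff i q"
  by (rule cpoly_eqI, rule eval_pdiff_eqI)
     (auto simp: eval_simps intro!: derivative_eq_intros deriv_eval_pdiff)

lemma pdiff_mult:
  fixes p q :: "('n::finite) cpoly"
  shows "pdiff i (p * q) = pdiff i p * q + p * pdiff i q"
  by (rule cpoly_eqI, rule eval_pdiff_eqI)
     (auto simp: eval_simps vec_upd_same intro!: derivative_eq_intros deriv_eval_pdiff)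

lemma pdiff_Const: "pdiff i (Const c :: ('n::finite) cpoly) = 0"
  by (rule cpoly_eqI, rule eval_pdiff_eqI) (auto simp: eval_simps)

lemma pdiff_Var: "pdiff i (Var j :: ('n::finite) cpoly) = (if i = j then 1 else 0)"
  by (rule cpoly_eqI, rule eval_pdiff_eqI) (auto simp: eval_simps)

lemma vector_field_Var: "vector_field f (Var k) = f k"
  by (simp add: vector_field_def pdiff_Var if_distrib cong: if_cong)

lemma vector_field_in_Der: "vector_field f \<in> Der"
  by (auto simp: Der_def vector_field_def pdiff_add pdiff_mult pdiff_Const algebra_simps
      sum.distrib sum_distrib_left)

lemma DerD:
  assumes "L \<in> Der"
  shows "L (p + q) = L p + L q" "L (Const c * p) = Const c * L p" "L (p * q) = L p * q + p * L q"
  using assms by (auto simp: Der_def)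

lemma Der_Const:
  assumes "L \<in> Der"
  shows "L (Const c) = 0"
proof -
  have "L 1 = 0"
    using DerD(3)[OF assms, of 1 1] by simp
  then show ?thesis
    using DerD(2)[OF assms, of c 1] by simp
qed

lemma Der_eqI:
  fixes L M :: "('n::finite) cpoly \<Rightarrow> 'n cpoly"
  assumes "L \<in> Der" "M \<in> Der" "\<And>i. L (Var i) = M (Var i)"
  shows "L = M"
proof
  fix p
  show "L p = M p"
    by (induction p rule: cpoly_induct) (use assms in \<open>auto simp: DerD Der_Const\<close>)
qed

lemma Der_sum:
  assumes "L \<in> Der"
  shows "L (sum f A) = (\<Sum>a\<in>A. L (f a))"
proof -
  have "L 0 = 0"
    using DerD(1)[OF assms, of 0 0] by simp
  then show ?thesis
    by (induction A rule: infinite_finite_induct) (use assms in \<open>auto simp: DerD\<close>)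
qed

lemma act_der_in_Der:
  assumes "L \<in> Der" "invertible w"
  shows "act_der w L \<in> Der"
  unfolding Der_def act_der_def
  by (simp add: act_simps DerD[OF assms(1)] Der_Const[OF assms(1)] act_inverse[OF assms(2)])

section \<open>Linear forms\<close>

lemma VdualE:
  assumes "a \<in> Vdual"
  obtains c where "a = (\<Sum>i\<in>UNIV. Const (c i) * Var i)" "\<And>v. eval a v = (\<Sum>i\<in>UNIV. c i * v $ i)"
  using assms by (auto simp: Vdual_def eval_simps)

lemma VdualI: "(\<Sum>i\<in>UNIV. Const (c i) * Var i) \<in> Vdual"
  by (simp add: Vdual_def)

lemma Vdual_add:
  assumes "a \<in> Vdual" "b \<in> Vdual"
  shows "a + b \<in> Vdual"
proof -
  obtain c d where "a = (\<Sum>i\<in>UNIV. Const (c i) * Var i)" "b = (\<Sum>i\<in>UNIV. Const (d i) * Var i)"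
    using assms by (auto simp: Vdual_def)
  then have "a + b = (\<Sum>i\<in>UNIV. Const (c i + d i) * Var i)"
    by (intro cpoly_eqI) (simp add: eval_simps sum.distrib algebra_simps)
  then show ?thesis
    by (simp add: VdualI)
qed

lemma Vdual_Const_mult:
  assumes "a \<in> Vdual"
  shows "Const c * a \<in> Vdual"
proof -
  obtain d where "a = (\<Sum>i\<in>UNIV. Const (d i) * Var i)"
    using assms by (auto simp: Vdual_def)
  then have "Const c * a = (\<Sum>i\<in>UNIV. Const (c * d i) * Var i)"
    by (intro cpoly_eqI) (simp add: eval_simps sum_distrib_left algebra_simps)
  then show ?thesis
    by (simp add: VdualI)
qed

lemma Vdual_Var: "Var i \<in> Vdual"
proof -
  have "Var i = (\<Sum>j\<in>UNIV. Const (if j = i then 1 else 0) * Var j)"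
    by (intro cpoly_eqI) (simp add: eval_simps if_distrib[of "\<lambda>x. x * _"] cong: if_cong)
  then show ?thesis
    using VdualI by metis
qed

lemma Vdual_0: "0 \<in> Vdual"
  using Vdual_Const_mult[OF Vdual_Var, of 0] by (simp add: Const_0)

lemma Vdual_sum: "(\<And>i. i \<in> A \<Longrightarrow> f i \<in> Vdual) \<Longrightarrow> sum f A \<in> Vdual"
  by (induction A rule: infinite_finite_induct) (auto simp: Vdual_0 Vdual_add)

lemma Vdual_act:
  assumes "a \<in> Vdual"
  shows "act w a \<in> Vdual"
proof -
  obtain c where c: "a = (\<Sum>i\<in>UNIV. Const (c i) * Var i)"
    using assms by (auto simp: Vdual_def)
  have "act w a = (\<Sum>i\<in>UNIV. Const (c i) * (\<Sum>j\<in>UNIV. Const (matrix_inv w $ i $ j) * Var j))"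
    by (rule cpoly_eqI) (simp add: c eval_simps matrix_vector_mult_def)
  then show ?thesis
    by (simp add: Vdual_sum Vdual_Const_mult Vdual_Var)
qed

lemma eval_Vdual:
  assumes "a \<in> Vdual"
  shows "eval a (v + v') = eval a v + eval a v'" "eval a (c *s v) = c * eval a v"
  using assms
  by (auto elim!: VdualE simp: algebra_simps sum.distrib sum_distrib_left)

section \<open>Matrices fixing a hyperplane\<close>

text \<open>The map sending \<open>v\<close> to \<open>v - eval a v *s u\<close> projects onto the
  kernel of \<open>a\<close>. Modulo \<open>a\<close>, every polynomial is congruent to its
  composition with this projection, and for \<open>p\<close> that composition is zero.\<close>

lemma linear_form_dvd:
  fixes p :: "('n::finite) cpoly"
  assumes "eval a u = 1" and zero: "\<And>v. eval a v = 0 \<Longrightarrow> eval p v = 0" and a: "a \<in> Vdual"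
  shows "a dvd p"
proof -
  have "\<exists>q. a dvd p - q \<and> (\<forall>v. eval q v = eval p (v - eval a v *s u))" for p :: "'n cpoly"
  proof (induction p rule: cpoly_induct)
    case (Const c)
    show ?case by (rule exI[of _ "Const c"]) (simp add: eval_simps)
  next
    case (Var i)
    \<comment> \<open>This is coordinate \<open>i\<close> of the projected vector.\<close>
    show ?case by (rule exI[of _ "Var i - Const (u $ i) * a"]) (simp add: eval_simps)
  next
    case (add p q)
    then obtain p' q' where "a dvd p - p'" "\<forall>v. eval p' v = eval p (v - eval a v *s u)"
      "a dvd q - q'" "\<forall>v. eval q' v = eval q (v - eval a v *s u)" by auto
    then show ?case
      using dvd_add[of a "p - p'" "q - q'"]
      by (intro exI[of _ "p' + q'"]) (simp add: eval_simps algebra_simps)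
  next
    case (mult p q)
    then obtain p' q' where *: "a dvd p - p'" "\<forall>v. eval p' v = eval p (v - eval a v *s u)"
      "a dvd q - q'" "\<forall>v. eval q' v = eval q (v - eval a v *s u)" by auto
    have "p * q - p' * q' = (p - p') * q + p' * (q - q')"
      by (simp add: algebra_simps)
    then show ?case
      using * by (intro exI[of _ "p' * q'"]) (simp add: eval_simps)
  qed
  then obtain q where q: "a dvd p - q" "\<And>v. eval q v = eval p (v - eval a v *s u)"
    by blast
  have "eval a (v - eval a v *s u) = 0" for v
    using eval_Vdual(1)[OF a, of "v - eval a v *s u" "eval a v *s u"] assms(1)
    by (simp add: eval_Vdual[OF a])
  then have "q = 0"
    using q(2) zero by (intro eval_eq_0_imp) simp
  then show ?thesis
    using q(1) by simp
qed

text \<open>Continuity along a line, used to carry an identity valid off a hyperplane over to its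
  points.\<close>

lemma tendsto_eval:
  "((\<lambda>t. eval p (v + t *s u)) \<longlongrightarrow> eval p v) (at (0::complex))"
proof (induction p rule: cpoly_induct)
  case (Var i)
  have "((\<lambda>t. v $ i + t * u $ i) \<longlongrightarrow> v $ i + 0 * u $ i) (at (0::complex))"
    by (intro tendsto_intros)
  then show ?case by (simp add: eval_simps)
qed (auto simp: eval_simps intro!: tendsto_intros)

text \<open>The component \<open>v - eval a v *s u\<close> lies in the kernel of \<open>a\<close>
  and is therefore fixed; only the multiple of \<open>u\<close> moves.\<close>

lemma fixes_kernel_expand:
  assumes a: "a \<in> Vdual" and u: "eval a u = 1"
    and fix_w: "\<And>v. eval a v = 0 \<Longrightarrow> w *v v = v"
  shows "w *v v = v + eval a v *s (w *v u - u)"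
proof -
  have "eval a (v + (- eval a v) *s u) = 0"
    by (simp only: eval_Vdual[OF a] u) simp
  from fix_w[OF this] show ?thesis
    by (simp add: matrix_vector_right_distrib vector_scalar_commute matrix_vector_mult_diff_distrib
        vector_ssub_ldistrib algebra_simps vec.neg)
qed

text \<open>
  If row \<open>j\<close> of the identity matrix is replaced by the coefficients of \<open>a\<close>, the resulting
  matrix \<open>P\<close> satisfies \<open>P w = Q P\<close>, where \<open>Q\<close> differs from the identity only in column \<open>j\<close>;
  both \<open>det P\<close> and \<open>det Q\<close> are given by Cramer's lemma.
\<close>

lemma det_fixes_kernel:
  fixes w :: "complex ^ 'n ^ 'n"
  assumes a: "a \<in> Vdual" and u: "eval a u = 1"
    and fix_w: "\<And>v. eval a v = 0 \<Longrightarrow> w *v v = v"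
  shows "det w = eval a (w *v u)"
proof -
  obtain c where c: "\<And>v. eval a v = (\<Sum>i\<in>UNIV. c i * v $ i)"
    using VdualE[OF a] by metis
  \<comment> \<open>Such a \<open>j\<close> exists because \<open>eval a u = 1\<close>; it makes
    \<open>det P = c j\<close> nonzero, hence cancellable at the end.\<close>
  obtain j where j: "c j \<noteq> 0"
    using u c[of u] by (metis (no_types, lifting) mult_zero_left sum.neutral zero_neq_one)
  define d where "d = eval a (w *v u)"
  define b where "b = w *v u - u"
  define P :: "complex ^ 'n ^ 'n"
    where "P = (\<chi> i l. if i = j then c l else mat 1 $ i $ l)"
  define y :: "complex ^ 'n" where "y = (\<chi> i. if i = j then d else b $ i)"
  define Q :: "complex ^ 'n ^ 'n"
    where "Q = (\<chi> i l. if l = j then (mat 1 *v y) $ i else mat 1 $ i $ l)"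
  \<comment> \<open>Cramer's lemma replaces a column, whereas \<open>P\<close> has a replaced
    row.\<close>
  have "transpose P = (\<chi> l i. if i = j then (mat 1 *v (\<chi> l. c l)) $ l else mat 1 $ l $ i)"
    by (simp add: P_def transpose_def vec_eq_iff) (simp add: mat_def)
  then have "det P = c j"
    using cramer_lemma[of j "mat 1" "\<chi> l. c l"] det_transpose[of P] by simp
  have "det Q = d"
    using cramer_lemma[of j "mat 1" y] by (simp add: Q_def y_def)
  have P: "(P *v x) $ i = (if i = j then eval a x else x $ i)" for x i
    by (simp add: P_def matrix_vector_mult_def c mat_def if_distrib[of "\<lambda>z. z * _"] cong: if_cong)
  have Q: "(Q *v x) $ i = y $ i * x $ j + (if i = j then 0 else x $ i)" for x i
  proof -
    have "(Q *v x) $ i = y $ i * x $ j + (\<Sum>l\<in>UNIV - {j}. (if i = l then 1 else 0) * x $ l)"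
      unfolding Q_def matrix_vector_mul_lid unfolding matrix_vector_mult_def
      by (subst sum.remove[of UNIV j]) (auto simp: mat_def intro!: sum.cong)
    also have "(\<Sum>l\<in>UNIV - {j}. (if i = l then 1 else 0) * x $ l) = (if i = j then 0 else x $ i)"
      by (simp add: if_distrib[of "\<lambda>z. z * _"] cong: if_cong)
    finally show ?thesis .
  qed
  have w: "w *v v = v + eval a v *s b" for v
    unfolding b_def by (rule fixes_kernel_expand) (use assms in auto)
  have ab: "eval a b = d - 1"
    using eval_Vdual(1)[OF a, of b u] u by (simp add: b_def d_def)
  \<comment> \<open>Applied to \<open>x\<close>, both sides have entry \<open>d * eval a x\<close>
    in row \<open>j\<close> and \<open>x $ i + eval a x * b $ i\<close> in every other row
    \<open>i\<close>.\<close>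
  have "P ** w = Q ** P"
    unfolding matrix_eq
    by (simp add: matrix_vector_mul_assoc[symmetric] vec_eq_iff P Q y_def)
       (simp add: w eval_Vdual[OF a] ab algebra_simps)
  then have "det P * det w = det Q * det P"
    by (metis det_mul)
  then show ?thesis
    using \<open>det P = c j\<close> \<open>det Q = d\<close> j by (simp add: d_def)
qed

text \<open>Determinant 1 puts the displacement \<open>b\<close> of \<open>u\<close> into the kernel
  of \<open>a\<close>, so the powers of \<open>w\<close> translate \<open>u\<close> by the multiples
  of \<open>b\<close>. In a finite \<open>W\<close> these cannot all be distinct, which forces
  \<open>b = 0\<close>.\<close>

lemma finite_order_transvection_trivial:
  fixes w :: "complex ^ 'n ^ 'n"
  assumes a: "a \<in> Vdual" and u: "eval a u = 1"
    and fix_w: "\<And>v. eval a v = 0 \<Longrightarrow> w *v v = v"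
    and "finite W" "w \<in> W" and mult: "\<And>x y. \<lbrakk>x \<in> W; y \<in> W\<rbrakk> \<Longrightarrow> x ** y \<in> W"
    and "det w = 1"
  shows "w = mat 1"
proof -
  define b where "b = w *v u - u"
  have w: "w *v v = v + eval a v *s b" for v
    unfolding b_def by (rule fixes_kernel_expand) (use assms in auto)
  have "eval a (w *v u) = 1"
    using det_fixes_kernel[OF a u fix_w] \<open>det w = 1\<close> by simp
  then have ab: "eval a b = 0"
    using eval_Vdual(1)[OF a, of b u] u by (simp add: b_def)
  \<comment> \<open>The witness is a power of \<open>w\<close>; counting from \<open>Suc k\<close>
    starts at \<open>w\<close> itself, as \<open>W\<close> is only assumed closed under
    products.\<close>
  have "\<exists>x\<in>W. x *v u = u + of_nat (Suc k) *s b" for k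
  proof (induction k)
    case 0
    then show ?case using \<open>w \<in> W\<close> w[of u] u by auto
  next
    case (Suc k)
    then obtain x where x: "x \<in> W" "x *v u = u + of_nat (Suc k) *s b" by blast
    have "(w ** x) *v u = u + of_nat (Suc (Suc k)) *s b"
      unfolding matrix_vector_mul_assoc[symmetric] x(2) w
      by (simp only: eval_Vdual[OF a] u ab) (simp add: vec_eq_iff algebra_simps)
    then show ?case using x(1) mult \<open>w \<in> W\<close> by blast
  qed
  then have "range (\<lambda>k. u + of_nat (Suc k) *s b) \<subseteq> (\<lambda>x. x *v u) ` W"
    by (metis (no_types, lifting) image_eqI image_subsetI)
  then have "finite (range (\<lambda>k. u + of_nat (Suc k) *s b))"
    using \<open>finite W\<close> finite_subset by blast
  then have "\<not> inj (\<lambda>k. u + of_nat (Suc k) *s b)"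
    using range_inj_infinite by blast
  then obtain k l where "k \<noteq> l" "u + of_nat (Suc k) *s b = u + of_nat (Suc l) *s b"
    unfolding inj_def by blast
  then have "b = 0"
    by (simp add: vec_eq_iff)
  then show ?thesis
    unfolding matrix_eq w by simp
qed

section \<open>Finite multiplicative groups of complex numbers\<close>

text \<open>Multiplication by an element is injective on the finite set \<open>G\<close>, hence
  permutes it. Comparing the product over \<open>G\<close> before and after gives the first claim;
  comparing power sums gives the second.\<close>

lemma
  fixes G :: "complex set"
  assumes "finite G" "0 \<notin> G" and mult: "\<And>x y. \<lbrakk>x \<in> G; y \<in> G\<rbrakk> \<Longrightarrow> x * y \<in> G"
  shows power_card_finite_group: "z \<in> G \<Longrightarrow> z ^ card G = 1"
    and sum_power_finite_group: "\<lbrakk>0 < i; i < card G\<rbrakk> \<Longrightarrow> (\<Sum>x\<in>G. x ^ i) = 0"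
proof -
  have bij: "bij_betw ((*) z) G G" if "z \<in> G" for z
  proof -
    have "inj_on ((*) z) G"
      using that \<open>0 \<notin> G\<close> by (auto simp: inj_on_def)
    then show ?thesis
      using endo_inj_surj[OF \<open>finite G\<close>] mult[OF that] by (auto simp: bij_betw_def)
  qed
  show "z ^ card G = 1" if "z \<in> G"
  proof -
    have "\<Prod>G = (\<Prod>x\<in>G. z * x)"
      using prod.reindex_bij_betw[OF bij[OF that], of "\<lambda>x. x"] by simp
    also have "\<dots> = z ^ card G * \<Prod>G"
      by (simp add: prod.distrib)
    finally show ?thesis
      using \<open>finite G\<close> \<open>0 \<notin> G\<close> by auto
  qed
  show "(\<Sum>x\<in>G. x ^ i) = 0" if "0 < i" "i < card G"
  proof -
    \<comment> \<open>At most \<open>i\<close> roots of unity satisfy \<open>x ^ i = 1\<close>, too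
      few to exhaust \<open>G\<close>.\<close>
    have "card {x::complex. x ^ i = 1} < card G"
      by (rule le_less_trans[OF card_roots_unity that(2)]) (use that(1) in simp)
    then have "\<not> G \<subseteq> {x. x ^ i = 1}"
      using card_mono[of "{x::complex. x ^ i = 1}" G] finite_roots_unity[of i] that by fastforce
    then obtain z where z: "z \<in> G" "z ^ i \<noteq> 1"
      by blast
    have "(\<Sum>x\<in>G. x ^ i) = (\<Sum>x\<in>G. (z * x) ^ i)"
      using sum.reindex_bij_betw[OF bij[OF z(1)], of "\<lambda>x. x ^ i"] by simp
    also have "\<dots> = z ^ i * (\<Sum>x\<in>G. x ^ i)"
      by (simp add: power_mult_distrib sum_distrib_left)
    finally show ?thesis
      using z(2) by simp
  qed
qed

section \<open>The stabiliser of a reflection hyperplane\<close>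

lemma
  fixes W :: "(complex ^ 'n ^ 'n) set"
  assumes "finite_reflection_group W"
  shows reflection_group_finite: "finite W"
    and reflection_group_invertible: "w \<in> W \<Longrightarrow> invertible w"
    and reflection_group_one: "mat 1 \<in> W"
    and reflection_group_mult: "\<lbrakk>w \<in> W; x \<in> W\<rbrakk> \<Longrightarrow> w ** x \<in> W"
    and reflection_group_inverse: "w \<in> W \<Longrightarrow> matrix_inv w \<in> W"
proof -
  have sub: "subgroup W GL"
    using assms by (simp add: finite_reflection_group_def)
  show "finite W"
    using assms by (simp add: finite_reflection_group_def)
  show inv: "invertible w" if "w \<in> W" for w
    using subgroup.subset[OF sub] that by (auto simp: GL_def)
  show "mat 1 \<in> W"
    using subgroup.one_closed[OF sub] by (simp add: GL_def)
  show "w ** x \<in> W" if "w \<in> W" "x \<in> W"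
    using subgroup.m_closed[OF sub that] by (simp add: GL_def)
  show "matrix_inv w \<in> W" if "w \<in> W"
  proof -
    note i = matrix_inv_mult[OF inv[OF that]]
    have "inv\<^bsub>GL\<^esub> w = matrix_inv w"
      unfolding m_inv_def
    proof (rule the_equality)
      show "matrix_inv w \<in> carrier GL \<and> w \<otimes>\<^bsub>GL\<^esub> matrix_inv w = \<one>\<^bsub>GL\<^esub> \<and>
          matrix_inv w \<otimes>\<^bsub>GL\<^esub> w = \<one>\<^bsub>GL\<^esub>"
        using i invertible_matrix_inv[OF inv[OF that]] by (simp add: GL_def)
      fix y
      assume "y \<in> carrier GL \<and> w \<otimes>\<^bsub>GL\<^esub> y = \<one>\<^bsub>GL\<^esub> \<and> y \<otimes>\<^bsub>GL\<^esub> w = \<one>\<^bsub>GL\<^esub>"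
      then show "y = matrix_inv w"
        using i by (simp add: GL_def) (metis matrix_mul_assoc matrix_mul_lid matrix_mul_rid)
    qed
    then show ?thesis
      using subgroup.m_inv_closed[OF sub that] by simp
  qed
qed

text \<open>Here \<open>a\<close> is the form defining \<open>H\<close>, \<open>u\<close> a vector
  transversal to \<open>H\<close> normalised by \<open>a\<close>, and \<open>s\<close> a witness
  that the stabiliser is nontrivial.\<close>

locale reflection_hyperplane =
  fixes W :: "(complex ^ 'n ^ 'n) set" and H :: "(complex ^ 'n) set"
    and a :: "'n cpoly" and u :: "complex ^ 'n" and s :: "complex ^ 'n ^ 'n"
  assumes W: "finite_reflection_group W"
    and a: "a \<in> Vdual" and H: "H = {v. eval a v = 0}" and u: "eval a u = 1"
    and s: "s \<in> stab W H" "s \<noteq> mat 1"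
begin

lemma finite_stab: "finite (stab W H)"
  using reflection_group_finite[OF W] by (simp add: stab_def)

lemma stab_W: "w \<in> stab W H \<Longrightarrow> w \<in> W"
  by (simp add: stab_def)

lemma stab_invertible: "w \<in> stab W H \<Longrightarrow> invertible w"
  using reflection_group_invertible[OF W] stab_W by blast

lemma stab_fix: "w \<in> stab W H \<Longrightarrow> eval a v = 0 \<Longrightarrow> w *v v = v"
  by (simp add: stab_def H)

lemma stab_one: "mat 1 \<in> stab W H"
  using reflection_group_one[OF W] by (simp add: stab_def)

lemma stab_mult: "w \<in> stab W H \<Longrightarrow> x \<in> stab W H \<Longrightarrow> w ** x \<in> stab W H"
  using reflection_group_mult[OF W] by (simp add: stab_def matrix_vector_mul_assoc[symmetric])

lemma stab_inverse:
  assumes "w \<in> stab W H"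
  shows "matrix_inv w \<in> stab W H"
proof -
  have "matrix_inv w *v v = v" if "v \<in> H" for v
  proof -
    have "matrix_inv w *v (w *v v) = v"
      by (simp add: matrix_vector_mul_assoc matrix_inv_mult(2)[OF stab_invertible[OF assms]])
    moreover have "w *v v = v"
      using assms that by (simp add: stab_def)
    ultimately show ?thesis
      by simp
  qed
  then show ?thesis
    using reflection_group_inverse[OF W] assms by (simp add: stab_def)
qed

lemma stab_apply: "w \<in> stab W H \<Longrightarrow> w *v v = v + eval a v *s (w *v u - u)"
  by (rule fixes_kernel_expand[OF a u stab_fix])

text \<open>Applying \<open>a\<close> to \<open>stab_apply\<close> multiplies
  \<open>eval a v\<close> by \<open>eval a (w *v u)\<close>, which is the determinant by
  \<open>det_fixes_kernel\<close>.\<close>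

lemma eval_stab_apply:
  assumes "w \<in> stab W H"
  shows "eval a (w *v v) = det w * eval a v"
proof -
  have d: "det w = eval a (w *v u)"
    by (rule det_fixes_kernel[OF a u stab_fix[OF assms]])
  have "eval a (w *v u - u) = det w - 1"
    using eval_Vdual(1)[OF a, of "w *v u - u" u] u d by simp
  then show ?thesis
    by (subst stab_apply[OF assms]) (simp only: eval_Vdual[OF a], simp add: algebra_simps)
qed

lemma det_stab_nonzero: "w \<in> stab W H \<Longrightarrow> det w \<noteq> 0"
  using stab_invertible invertible_det_nz by blast

lemma act_a:
  assumes "w \<in> stab W H"
  shows "act w a = Const (inverse (det w)) * a"
proof (rule cpoly_eqI)
  fix v
  have "eval a v = det w * eval a (matrix_inv w *v v)"
    using eval_stab_apply[OF assms, of "matrix_inv w *v v"] matrix_inv_mult(1)[OF stab_invertible[OF assms]]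
    by (simp add: matrix_vector_mul_assoc)
  then show "eval (act w a) v = eval (Const (inverse (det w)) * a) v"
    using det_stab_nonzero[OF assms] by (simp add: eval_simps)
qed

lemma act_Vdual_stab:
  assumes "w \<in> stab W H" "b \<in> Vdual"
  shows "\<exists>k. act w b = b + Const k * a"
proof (intro exI cpoly_eqI)
  fix v
  \<comment> \<open>The witness left open above becomes
    \<open>eval b (matrix_inv w *v u - u)\<close>, which does not depend on
    \<open>v\<close>.\<close>
  have "eval (act w b) v = eval b (v + eval a v *s (matrix_inv w *v u - u))"
    by (simp only: eval_act) (subst stab_apply[OF stab_inverse[OF assms(1)]], rule refl)
  then show "eval (act w b) v = eval (b + Const (eval b (matrix_inv w *v u - u)) * a) v"
    by (simp only: eval_Vdual[OF assms(2)] eval_simps mult.commute)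
qed

text \<open>If two determinants agree, the quotient fixes \<open>H\<close> with determinant 1, and
  the finiteness of \<open>W\<close> makes it trivial.\<close>

lemma inj_on_det: "inj_on det (stab W H)"
proof (rule inj_onI)
  fix w x
  assume w: "w \<in> stab W H" and x: "x \<in> stab W H" and "det w = det x"
  note i = matrix_inv_mult[OF stab_invertible[OF w]]
  have y: "matrix_inv w ** x \<in> stab W H"
    using w x by (intro stab_mult stab_inverse)
  have "det (matrix_inv w ** x) = det (matrix_inv w ** w)"
    using \<open>det w = det x\<close> by (simp add: det_mul)
  then have "det (matrix_inv w ** x) = 1"
    by (simp add: i)
  then have "matrix_inv w ** x = mat 1"
    using stab_W[OF y] reflection_group_finite[OF W] reflection_group_mult[OF W] stab_fix[OF y]
    by (intro finite_order_transvection_trivial[OF a u, of _ W]) auto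
  then show "w = x"
    by (metis i(1) matrix_mul_assoc matrix_mul_lid matrix_mul_rid)
qed

lemma det_stab_group:
  "finite (det ` stab W H)" "0 \<notin> det ` stab W H"
  "x \<in> det ` stab W H \<Longrightarrow> y \<in> det ` stab W H \<Longrightarrow> x * y \<in> det ` stab W H"
  using finite_stab det_stab_nonzero
  by (auto simp: det_mul[symmetric] intro!: imageI stab_mult)

lemma det_power_card: "w \<in> stab W H \<Longrightarrow> det w ^ card (stab W H) = 1"
  using power_card_finite_group[OF det_stab_group, of "det w"] card_image[OF inj_on_det] by simp

lemma sum_det_power: "0 < i \<Longrightarrow> i < card (stab W H) \<Longrightarrow> (\<Sum>w\<in>stab W H. det w ^ i) = 0"
  using sum_power_finite_group[OF det_stab_group, of i]
  by (simp add: card_image[OF inj_on_det] sum.reindex[OF inj_on_det])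

text \<open>Ensures that the index 1 occurs among the conditions defining quasi-invariants.\<close>

lemma card_stab_ge_2: "2 \<le> card (stab W H)"
proof -
  have "card {mat 1, s} \<le> card (stab W H)"
    using stab_one s finite_stab by (intro card_mono) auto
  then show ?thesis
    using s(2) by auto
qed

lemma det_s: "det s \<noteq> 1"
  using inj_onD[OF inj_on_det, of s "mat 1"] s stab_one by auto

text \<open>
  Since \<open>a ^ (k * n)\<close> is \<open>W\<^sub>H\<close>-invariant, the cofactor of \<open>p\<close> is semi-invariant with the
  nontrivial character of \<open>p\<close>, hence vanishes on \<open>H\<close>.
\<close>

lemma semi_invariant_dvd:
  assumes semi: "act s p = Const (inverse (det s)) * p"
    and dvd: "a ^ (k * card (stab W H)) dvd p"
  shows "a ^ (k * card (stab W H) + 1) dvd p"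
proof -
  define N where "N = k * card (stab W H)"
  obtain g where g: "p = a ^ N * g"
    using dvd unfolding N_def by (rule dvdE)
  let ?d = "inverse (det s)"
  have dN: "?d ^ N = 1"
    using det_power_card[OF s(1)] by (simp add: N_def mult.commute[of k] power_mult power_inverse)
  have d: "?d \<noteq> 1"
    using det_s by (metis inverse_1 inverse_inverse_eq)
  have "a dvd g"
  proof (rule linear_form_dvd[OF u _ a])
    fix v
    assume v: "eval a v = 0"
    \<comment> \<open>The factor \<open>t ^ N\<close> can be cancelled only off \<open>H\<close>;
      the relation is therefore proved for nonzero \<open>t\<close> and reaches \<open>v\<close> in
      the limit as \<open>t\<close> tends to 0.\<close>
    have cofactor: "eval g (v + t *s (matrix_inv s *v u)) = ?d * eval g (v + t *s u)" if "t \<noteq> 0" for t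
    proof -
      have x: "eval a (v + t *s u) = t"
        using eval_Vdual[OF a] u v by simp
      have sv: "matrix_inv s *v v = v"
        using stab_fix[OF stab_inverse[OF s(1)] v] .
      have "eval (act s a) (v + t *s u) = ?d * t"
        by (simp add: act_a[OF s(1)] eval_simps x)
      then have y: "eval a (matrix_inv s *v (v + t *s u)) = ?d * t"
        by (simp add: eval_act)
      have "eval p (matrix_inv s *v (v + t *s u)) = ?d * eval p (v + t *s u)"
        using arg_cong[OF semi, of "\<lambda>q. eval q (v + t *s u)"] by (simp add: eval_simps)
      then have "t ^ N * eval g (matrix_inv s *v (v + t *s u)) = t ^ N * (?d * eval g (v + t *s u))"
        unfolding g eval_mult eval_power x y power_mult_distrib dN by simp
      then show ?thesis
        using that sv by (simp add: matrix_vector_right_distrib vector_scalar_commute)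
    qed
    have "((\<lambda>t. ?d * eval g (v + t *s u)) \<longlongrightarrow> ?d * eval g v) (at 0)"
      by (intro tendsto_intros tendsto_eval)
    moreover have "\<forall>\<^sub>F t in at 0. eval g (v + t *s (matrix_inv s *v u)) = ?d * eval g (v + t *s u)"
      using cofactor by (auto simp: eventually_at intro!: exI[of _ 1])
    ultimately have "((\<lambda>t. eval g (v + t *s (matrix_inv s *v u))) \<longlongrightarrow> ?d * eval g v) (at 0)"
      using tendsto_cong by force
    then have "eval g v = ?d * eval g v"
      using tendsto_unique[OF _ tendsto_eval] by (metis at_neq_bot)
    then show "eval g v = 0"
      using d by simp
  qed
  then show ?thesis
    unfolding g N_def[symmetric] by (simp add: mult.commute[of a] mult_dvd_mono)
qed

text \<open>The comparison at a single hyperplane. The map \<open>f\<close> is arbitrary so that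
  both an equivariant map on \<open>Vdual\<close> and an invariant derivation can be
  inserted.\<close>

lemma quasi_invariance_iff:
  fixes f :: "'n cpoly \<Rightarrow> 'n cpoly"
  assumes add: "\<And>b c. \<lbrakk>b \<in> Vdual; c \<in> Vdual\<rbrakk> \<Longrightarrow> f (b + c) = f b + f c"
    and scale: "\<And>c b. b \<in> Vdual \<Longrightarrow> f (Const c * b) = Const c * f b"
    and equi: "\<And>w b. \<lbrakk>w \<in> W; b \<in> Vdual\<rbrakk> \<Longrightarrow> f (act w b) = act w (f b)"
  shows "(\<forall>b\<in>Vdual. \<forall>i\<in>{1..card (stab W H) - 1}. a ^ (k * card (stab W H)) dvd e_op W H i (f b))
    \<longleftrightarrow> a ^ (k * card (stab W H) + 1) dvd f a" (is "?Q \<longleftrightarrow> ?D")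
proof
  have act_fa: "act w (f a) = Const (inverse (det w)) * f a" if "w \<in> stab W H" for w
    using equi[OF stab_W[OF that] a] by (simp add: act_a[OF that] scale[OF a])
  assume ?Q
  then have "a ^ (k * card (stab W H)) dvd e_op W H 1 (f a)"
    using a card_stab_ge_2 by auto
  \<comment> \<open>For \<open>i = 1\<close> the weight \<open>det w\<close> cancels the character
    of \<open>f a\<close>, so all summands are equal.\<close>
  also have "e_op W H 1 (f a) = (\<Sum>w\<in>stab W H. f a)"
    unfolding e_op_def
    by (intro sum.cong refl)
       (simp add: act_fa mult.assoc[symmetric] Const_mult[symmetric] det_stab_nonzero Const_1)
  finally have "a ^ (k * card (stab W H)) dvd Const (of_nat (card (stab W H))) * f a"
    by (simp add: Const_def)
  then have "a ^ (k * card (stab W H)) dvd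
      Const (inverse (of_nat (card (stab W H)))) * (Const (of_nat (card (stab W H))) * f a)"
    by (rule dvd_mult)
  then have "a ^ (k * card (stab W H)) dvd f a"
    using card_stab_ge_2 by (simp add: mult.assoc[symmetric] Const_mult[symmetric] Const_1)
  then show ?D
    by (rule semi_invariant_dvd[OF act_fa[OF s(1)]])
next
  assume ?D
  then have D: "a ^ (k * card (stab W H)) dvd f a"
    by (simp add: dvd_mult_right)
  show ?Q
  proof (intro ballI)
    fix b :: "'n cpoly" and i
    assume b: "b \<in> Vdual" and i: "i \<in> {1..card (stab W H) - 1}"
    obtain c where c: "\<And>w. w \<in> stab W H \<Longrightarrow> act w b = b + Const (c w) * a"
      using act_Vdual_stab[OF _ b] by metis
    have "act w (f b) = f b + Const (c w) * f a" if "w \<in> stab W H" for w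
      using equi[OF stab_W[OF that] b] c[OF that] add[OF b Vdual_Const_mult[OF a]] scale[OF a]
      by simp
    \<comment> \<open>The fixed part \<open>f b\<close> collects the power sum of the determinants,
      which vanishes; only a multiple of \<open>f a\<close> survives.\<close>
    then have "e_op W H i (f b) =
        Const (\<Sum>w\<in>stab W H. det w ^ i) * f b +
        (\<Sum>w\<in>stab W H. Const (det w ^ i) * Const (c w)) * f a"
      by (simp add: e_op_def Const_sum sum_distrib_left sum.distrib algebra_simps)
    also have "(\<Sum>w\<in>stab W H. det w ^ i) = 0"
      using i by (intro sum_det_power) auto
    finally show "a ^ (k * card (stab W H)) dvd e_op W H i (f b)"
      using D by (simp add: Const_0)
  qed
qed

end

text \<open>A reflection with fixed space \<open>H\<close> serves as \<open>s\<close>. As its fixed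
  space is proper, the form is nonzero somewhere, and rescaling gives \<open>u\<close>.\<close>

lemma reflection_hyperplane_exists:
  fixes W :: "(complex ^ 'n ^ 'n) set"
  assumes W: "finite_reflection_group W" and forms: "defining_forms W \<alpha>" and H: "H \<in> arrangement W"
  shows "\<exists>u s. reflection_hyperplane W H (\<alpha> H) u s"
proof -
  obtain s where s: "s \<in> W" "is_reflection s" "H = fixspace s"
    using H by (auto simp: arrangement_def reflections_def)
  have a: "\<alpha> H \<in> Vdual" "H = {v. eval (\<alpha> H) v = 0}"
    using forms H by (auto simp: defining_forms_def)
  have "vec.dim (fixspace s) \<noteq> CARD('n)"
    using s(2) by (simp add: is_reflection_def)
  then have "H \<noteq> UNIV"
    using s(3) vec.dim_UNIV by (metis card_cart_basis vec.dimension_def)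
  then obtain v where v: "eval (\<alpha> H) v \<noteq> 0"
    using a(2) by blast
  have "eval (\<alpha> H) (inverse (eval (\<alpha> H) v) *s v) = 1"
    using v by (simp add: eval_Vdual[OF a(1)])
  moreover have "s \<in> stab W H"
    using s by (simp add: stab_def fixspace_def)
  moreover have "s \<noteq> mat 1"
    using \<open>H \<noteq> UNIV\<close> s(3) by (auto simp: fixspace_def)
  ultimately show ?thesis
    unfolding reflection_hyperplane_def using W a by blast
qed

section \<open>The isomorphism\<close>

lemma e_op_add: "e_op W H i (p + q) = e_op W H i p + e_op W H i q"
  by (simp add: e_op_def act_add algebra_simps sum.distrib)

lemma e_op_uminus: "e_op W H i (- p) = - e_op W H i p"
  by (simp add: e_op_def act_uminus sum_negf)

lemma e_op_0: "e_op W H i 0 = 0"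
  by (simp add: e_op_def act_0)

lemma e_op_invariant_mult:
  assumes "\<And>w. w \<in> W \<Longrightarrow> act w p = p"
  shows "e_op W H i (p * q) = p * e_op W H i q"
  unfolding e_op_def sum_distrib_left
  by (rule sum.cong) (simp_all add: act_mult assms stab_def algebra_simps)

lemma cring_invariant_ring: "cring (invariant_ring (W :: (complex ^ 'n ^ 'n) set))"
proof (rule cringI)
  show "abelian_group (invariant_ring W)"
  proof (rule abelian_groupI)
    fix p
    assume "p \<in> carrier (invariant_ring W)"
    then show "\<exists>q\<in>carrier (invariant_ring W). q \<oplus>\<^bsub>invariant_ring W\<^esub> p = \<zero>\<^bsub>invariant_ring W\<^esub>"
      by (intro bexI[of _ "- p"]) (simp_all add: invariant_ring_def act_uminus)
  qed (simp_all add: invariant_ring_def act_simps algebra_simps)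
  show "Group.comm_monoid (invariant_ring W)"
    by (rule comm_monoidI) (simp_all add: invariant_ring_def act_simps algebra_simps)
qed (simp_all add: invariant_ring_def algebra_simps)

lemma module_Hom:
  fixes W :: "(complex ^ 'n ^ 'n) set"
  shows "module (invariant_ring W) (Hom_module W (quasi_invariants W \<alpha> m))"
    (is "module ?R ?M")
proof (rule moduleI)
  note d = Hom_module_def equivariant_maps_def quasi_invariants_def invariant_ring_def
  note V = Vdual_add Vdual_Const_mult Vdual_act
  show "cring ?R"
    by (rule cring_invariant_ring)
  show "abelian_group ?M"
  proof (rule abelian_groupI)
    fix \<phi>
    assume "\<phi> \<in> carrier ?M"
    then show "\<exists>\<psi>\<in>carrier ?M. \<psi> \<oplus>\<^bsub>?M\<^esub> \<phi> = \<zero>\<^bsub>?M\<^esub>"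
      by (intro bexI[of _ "\<lambda>a\<in>Vdual. - \<phi> a"])
         (auto simp: d V e_op_uminus act_uminus PiE_def Pi_def)
  next
    fix \<phi>
    assume "\<phi> \<in> carrier ?M"
    \<comment> \<open>Equality of functions also needs extensionality: off \<open>Vdual\<close> both
      sides are \<open>undefined\<close>.\<close>
    then show "\<zero>\<^bsub>?M\<^esub> \<oplus>\<^bsub>?M\<^esub> \<phi> = \<phi>"
      by (auto simp: d PiE_def extensional_restrict restrict_def extensional_def fun_eq_iff)
  qed (auto simp: d V e_op_add e_op_0 act_simps PiE_def Pi_def extensional_def add_ac distrib_left
      fun_eq_iff restrict_def)
  fix p \<phi>
  assume "p \<in> carrier ?R" "\<phi> \<in> carrier ?M"
  then show "p \<odot>\<^bsub>?M\<^esub> \<phi> \<in> carrier ?M"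
    by (auto simp: d V e_op_invariant_mult act_simps PiE_def Pi_def distrib_left mult.left_commute)
next
  fix \<phi>
  assume "\<phi> \<in> carrier ?M"
  then show "\<one>\<^bsub>?R\<^esub> \<odot>\<^bsub>?M\<^esub> \<phi> = \<phi>"
    by (auto simp: Hom_module_def equivariant_maps_def invariant_ring_def PiE_def restrict_def extensional_def fun_eq_iff)
qed (auto simp: Hom_module_def invariant_ring_def algebra_simps fun_eq_iff restrict_def)

lemma module_invariant_fields:
  fixes W :: "(complex ^ 'n ^ 'n) set"
  shows "module (invariant_ring W) (invariant_fields_module W (log_fields W \<alpha> m))"
    (is "module ?R ?M")
proof (rule moduleI)
  note d = invariant_fields_module_def log_fields_def Der_def act_der_def invariant_ring_def
  show "cring ?R"
    by (rule cring_invariant_ring)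
  show "abelian_group ?M"
  proof (rule abelian_groupI)
    fix L
    assume "L \<in> carrier ?M"
    then show "\<exists>M\<in>carrier ?M. M \<oplus>\<^bsub>?M\<^esub> L = \<zero>\<^bsub>?M\<^esub>"
      by (intro bexI[of _ "\<lambda>q. - L q"]) (auto simp: d fun_eq_iff act_simps simp del: power_Suc)
  qed (auto simp: d fun_eq_iff act_simps algebra_simps simp del: power_Suc)
  fix p L
  assume "p \<in> carrier ?R" "L \<in> carrier ?M"
  then show "p \<odot>\<^bsub>?M\<^esub> L \<in> carrier ?M"
    by (auto simp: d fun_eq_iff act_simps algebra_simps simp del: power_Suc)
qed (auto simp: invariant_fields_module_def invariant_ring_def algebra_simps fun_eq_iff)

section \<open>The map \<open>Theta\<close> and its inverse\<close>

lemma Theta_in_Der: "Theta \<phi> \<in> Der"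
  by (simp add: Theta_def vector_field_in_Der)

text \<open>Both maps are linear on \<open>Vdual\<close> and agree on the coordinates; thus
  restriction to \<open>Vdual\<close> undoes \<open>Theta\<close>.\<close>

lemma Theta_Vdual:
  fixes \<phi> :: "('n::finite) cpoly \<Rightarrow> 'n cpoly"
  assumes \<phi>: "\<phi> \<in> equivariant_maps W Q" and a: "a \<in> Vdual"
  shows "Theta \<phi> a = \<phi> a"
proof -
  have add: "\<And>a b. \<lbrakk>a \<in> Vdual; b \<in> Vdual\<rbrakk> \<Longrightarrow> \<phi> (a + b) = \<phi> a + \<phi> b"
    and scale: "\<And>c a. a \<in> Vdual \<Longrightarrow> \<phi> (Const c * a) = Const c * \<phi> a"
    using \<phi> by (auto simp: equivariant_maps_def)
  have "\<phi> 0 = 0"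
    using scale[OF Vdual_0, of 0] by (simp add: Const_0)
  then have sum: "\<phi> (\<Sum>i\<in>A. Const (c i) * Var i) = (\<Sum>i\<in>A. Const (c i) * \<phi> (Var i))" for c and A :: "'n set"
    by (induction A rule: infinite_finite_induct)
       (auto simp: add scale Vdual_Var Vdual_Const_mult Vdual_sum)
  obtain c where "a = (\<Sum>i\<in>UNIV. Const (c i) * Var i)"
    using VdualE[OF a] by metis
  then show ?thesis
    by (simp add: sum Der_sum[OF Theta_in_Der] DerD(2)[OF Theta_in_Der])
       (simp add: Theta_def vector_field_Var)
qed

text \<open>Invariance is evaluated at \<open>act w b\<close>, where the inner inverse action
  cancels.\<close>

lemma invariant_derivation_equivariant:
  assumes "act_der w L = L" "invertible w"
  shows "L (act w b) = act w (L b)"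
proof -
  have "L (act w b) = act_der w L (act w b)"
    by (simp add: assms(1))
  also have "\<dots> = act w (L b)"
    by (simp add: act_der_def act_inverse[OF assms(2)])
  finally show ?thesis .
qed

lemma Theta_in_invariant_fields:
  fixes W :: "(complex ^ 'n ^ 'n) set"
  assumes W: "finite_reflection_group W" and forms: "defining_forms W \<alpha>"
    and \<phi>: "\<phi> \<in> carrier (Hom_module W (quasi_invariants W \<alpha> m))"
  shows "Theta \<phi> \<in> carrier (invariant_fields_module W (log_fields W \<alpha> m))"
proof -
  have \<phi>': "\<phi> \<in> equivariant_maps W (quasi_invariants W \<alpha> m)"
    using \<phi> by (simp add: Hom_module_def)
  note Th = Theta_Vdual[OF \<phi>']
  have log: "\<alpha> H ^ (m H * card (stab W H) + 1) dvd Theta \<phi> (\<alpha> H)" if HW: "H \<in> arrangement W" for H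
  proof -
    obtain u s where "reflection_hyperplane W H (\<alpha> H) u s"
      using reflection_hyperplane_exists[OF W forms HW] by blast
    then interpret reflection_hyperplane W H "\<alpha> H" u s .
    have "\<alpha> H ^ (m H * card (stab W H)) dvd e_op W H i (\<phi> b)"
      if "b \<in> Vdual" "i \<in> {1..card (stab W H) - 1}" for b i
      using \<phi>' that HW by (auto simp: equivariant_maps_def quasi_invariants_def PiE_def Pi_def)
    then have "\<alpha> H ^ (m H * card (stab W H) + 1) dvd \<phi> (\<alpha> H)"
      using \<phi>' by (subst quasi_invariance_iff[symmetric]) (auto simp: equivariant_maps_def)
    then show ?thesis
      using Th[OF a] by simp
  qed
  have "act_der w (Theta \<phi>) = Theta \<phi>" if w: "w \<in> W" for w
  proof -
    note inv = reflection_group_invertible[OF W w]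
    show ?thesis
    \<comment> \<open>Two derivations are compared on the variables only. The inverse action keeps
      these inside \<open>Vdual\<close>, where \<open>Theta \<phi>\<close> is the equivariant map
      \<open>\<phi>\<close>.\<close>
    proof (rule Der_eqI[OF act_der_in_Der[OF Theta_in_Der inv] Theta_in_Der])
      fix i
      have V: "act (matrix_inv w) (Var i) \<in> Vdual"
        by (intro Vdual_act Vdual_Var)
      then have "act w (\<phi> (act (matrix_inv w) (Var i))) = \<phi> (act w (act (matrix_inv w) (Var i)))"
        using \<phi>' w by (simp add: equivariant_maps_def)
      then show "act_der w (Theta \<phi>) (Var i) = Theta \<phi> (Var i)"
        by (simp add: act_der_def Th V Vdual_Var act_inverse[OF inv])
    qed
  qed
  then show ?thesis
    using log Theta_in_Der by (auto simp: invariant_fields_module_def log_fields_def)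
qed

text \<open>Provides the inverse of \<open>Theta\<close>: the criterion at each hyperplane is now
  read from divisibility to quasi-invariance.\<close>

lemma restrict_in_equivariant_maps:
  fixes W :: "(complex ^ 'n ^ 'n) set"
  assumes W: "finite_reflection_group W" and forms: "defining_forms W \<alpha>"
    and L: "L \<in> carrier (invariant_fields_module W (log_fields W \<alpha> m))"
  shows "restrict L Vdual \<in> carrier (Hom_module W (quasi_invariants W \<alpha> m))"
proof -
  have Der: "L \<in> Der" and inv: "\<And>w. w \<in> W \<Longrightarrow> act_der w L = L"
    and log: "\<And>H. H \<in> arrangement W \<Longrightarrow> \<alpha> H ^ (m H * card (stab W H) + 1) dvd L (\<alpha> H)"
    using L by (auto simp: invariant_fields_module_def log_fields_def)
  have equi: "L (act w b) = act w (L b)" if "w \<in> W" for w b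
    using invariant_derivation_equivariant[OF inv[OF that] reflection_group_invertible[OF W that]] .
  have "L b \<in> quasi_invariants W \<alpha> m" if b: "b \<in> Vdual" for b
    unfolding quasi_invariants_def
  proof (intro CollectI ballI)
    fix H i
    assume HW: "H \<in> arrangement W" and i: "i \<in> {1..card (stab W H) - 1}"
    obtain u s where "reflection_hyperplane W H (\<alpha> H) u s"
      using reflection_hyperplane_exists[OF W forms HW] by blast
    then interpret reflection_hyperplane W H "\<alpha> H" u s .
    have "\<forall>b\<in>Vdual. \<forall>i\<in>{1..card (stab W H) - 1}.
        \<alpha> H ^ (m H * card (stab W H)) dvd e_op W H i (L b)"
      using log[OF HW] by (subst quasi_invariance_iff) (simp_all add: DerD[OF Der] Der_Const[OF Der] equi)
    then show "\<alpha> H ^ (m H * card (stab W H)) dvd e_op W H i (L b)"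
      using b i by blast
  qed
  then show ?thesis
    by (auto simp: Hom_module_def equivariant_maps_def Vdual_add Vdual_Const_mult Vdual_act
        DerD(1,2)[OF Der] equi)
qed

theorem theorem3p4:
  fixes W :: "(complex ^ 'n ^ 'n) set"
    and m :: "(complex ^ 'n) set \<Rightarrow> nat"
    and \<alpha> :: "(complex ^ 'n) set \<Rightarrow> 'n cpoly"
  defines "R \<equiv> invariant_ring W"
    and "Hom \<equiv> Hom_module W (quasi_invariants W \<alpha> m)"
    and "DW \<equiv> invariant_fields_module W (log_fields W \<alpha> m)"
  assumes "finite_reflection_group W" and "irreducible_on_V W"
    and "invariant_mult W m"
    and "defining_forms W \<alpha>"
  shows "module R Hom \<and> module R DW \<and> Theta \<in> module_iso R Hom DW \<and>
    (\<forall>f. vector_field f \<in> carrier DW \<longrightarrow>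
       (\<forall>k. inv_into (carrier Hom) Theta (vector_field f) (Var k) = f k))"
proof (intro conjI)
  show "module R Hom"
    unfolding R_def Hom_def by (rule module_Hom)
  show "module R DW"
    unfolding R_def DW_def by (rule module_invariant_fields)
  have Theta_restrict: "Theta (restrict L Vdual) = L" if "L \<in> carrier DW" for L
  proof (rule Der_eqI[OF Theta_in_Der])
    show "L \<in> Der"
      using that by (simp add: DW_def invariant_fields_module_def log_fields_def)
    show "Theta (restrict L Vdual) (Var i) = L (Var i)" for i
      by (simp add: Theta_def vector_field_Var Vdual_Var)
  qed
  have restrict_Theta: "restrict (Theta \<phi>) Vdual = \<phi>" if "\<phi> \<in> carrier Hom" for \<phi>
  proof -
    have \<phi>: "\<phi> \<in> equivariant_maps W (quasi_invariants W \<alpha> m)"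
      using that by (simp add: Hom_def Hom_module_def)
    then have "\<phi> \<in> extensional Vdual"
      by (simp add: equivariant_maps_def PiE_def)
    then show ?thesis
      \<comment> \<open>Agreement on \<open>Vdual\<close> suffices, as both functions are
        \<open>undefined\<close> elsewhere.\<close>
      by (intro extensionalityI[of _ Vdual]) (simp_all add: Theta_Vdual[OF \<phi>])
  qed
  have bij: "bij_betw Theta (carrier Hom) (carrier DW)"
    using Theta_in_invariant_fields[OF assms(4,7), of _ m] restrict_in_equivariant_maps[OF assms(4,7), of _ m]
      Theta_restrict restrict_Theta
    by (intro bij_betwI[where g = "\<lambda>L. restrict L Vdual"]) (auto simp: Hom_def DW_def)
  moreover have "Theta (\<phi> \<oplus>\<^bsub>Hom\<^esub> \<psi>) = Theta \<phi> \<oplus>\<^bsub>DW\<^esub> Theta \<psi>" for \<phi> \<psi>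
    by (simp add: Hom_def DW_def Hom_module_def invariant_fields_module_def Theta_def
        vector_field_def Vdual_Var fun_eq_iff algebra_simps sum.distrib)
  moreover have "Theta (r \<odot>\<^bsub>Hom\<^esub> \<phi>) = r \<odot>\<^bsub>DW\<^esub> Theta \<phi>" for r \<phi>
    by (simp add: Hom_def DW_def Hom_module_def invariant_fields_module_def Theta_def
        vector_field_def Vdual_Var fun_eq_iff algebra_simps sum_distrib_left)
  ultimately show "Theta \<in> module_iso R Hom DW"
    by (simp add: module_iso_def)
  show "\<forall>f. vector_field f \<in> carrier DW \<longrightarrow>
      (\<forall>k. inv_into (carrier Hom) Theta (vector_field f) (Var k) = f k)"
  proof (intro allI impI)
    fix f k
    assume "vector_field f \<in> carrier DW"
    then have "Theta (inv_into (carrier Hom) Theta (vector_field f)) = vector_field f"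
      using bij_betw_inv_into_right[OF bij] by simp
    \<comment> \<open>Evaluating at \<open>Var k\<close> extracts coefficient \<open>k\<close> on
      both sides, and that of \<open>Theta \<phi>\<close> is \<open>\<phi> (Var k)\<close>.\<close>
    then have "Theta (inv_into (carrier Hom) Theta (vector_field f)) (Var k) = f k"
      by (simp add: vector_field_Var)
    then show "inv_into (carrier Hom) Theta (vector_field f) (Var k) = f k"
      by (simp add: Theta_def vector_field_Var)
  qed
qed

end
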